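(* (i) $\bar{R}(4;6)=5$. (ii) $\bar{R}(5;k)=6$ for $8\le k\le 10$. (iii) $\bar{R}(6;8)=11$, $\bar{R}(6;10)=8$, and $\bar{R}(6;k)=7$ for $11\le k\le 15$.
   Context: For a positive integer $n$, $[n]=\{1,\dots,n\}$. An edge-coloring of $K_n$ with $k$ colors is a map $f:\binom{[n]}{2}\to[k]$; for $i\in[k]$, $\alpha_i(f)$ is the independence number of the graph on $[n]$ whose edges are the pairs of color $i$. For positive integers $m_1,\dots,m_k$, $\bar{R}(m_1,\dots,m_k)$ is the least positive integer $n$ such that for every edge-coloring $f$ of $K_n$ with $k$ colors there exists $i\in[k]$ with $\alpha_i(f)\ge m_i$. $\bar{R}(m;k)$ denotes $\bar{R}(m,m,\dots,m)$ with $k$ arguments. *)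

theory Defs
  imports Main "HOL-Library.FuncSet" "HOL-Library.Ramsey"
begin

definition edge_colorings :: "nat \<Rightarrow> nat \<Rightarrow> (nat set \<Rightarrow> nat) set"
  where "edge_colorings n k = [{1..n}]\<^bsup>2\<^esup> \<rightarrow>\<^sub>E {1..k}"

definition color_class :: "nat \<Rightarrow> (nat set \<Rightarrow> nat) \<Rightarrow> nat \<Rightarrow> nat set set"
  where "color_class n f i = {e \<in> [{1..n}]\<^bsup>2\<^esup>. f e = i}"

definition independence_number :: "'a set \<Rightarrow> 'a set set \<Rightarrow> nat"
  where "independence_number V E = Max {card S |S. S \<subseteq> V \<and> indep S E}"

definition color_alpha :: "nat \<Rightarrow> (nat set \<Rightarrow> nat) \<Rightarrow> nat \<Rightarrow> nat"
  where "color_alpha n f i = independence_number {1..n} (color_class n f i)"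

text \<open>The list holds the arguments \<open>m\<^sub>1, \<dots>, m\<^sub>k\<close>. Colours are numbered from 1 but list
  positions from 0, hence the index shift. If no admissible \<open>n\<close> exists (for example one colour
  and \<open>m\<^sub>1 \<ge> 2\<close>), the value is unspecified.\<close>

definition Rbar :: "nat list \<Rightarrow> nat"
  where "Rbar ms = (LEAST n. 0 < n \<and>
    (\<forall>f \<in> edge_colorings n (length ms). \<exists>i \<in> {1..length ms}. color_alpha n f i \<ge> ms ! (i - 1)))"

definition Rbar_diag :: "nat \<Rightarrow> nat \<Rightarrow> nat"
  where "Rbar_diag m k = Rbar (replicate k m)"

end

theory Submission
  imports Defs "HOL-Library.Disjoint_Sets"
begin

text \<open>A colouring with every \<open>\<alpha>\<^sub>i < m\<close> is a packing of \<open>k\<close> graphs of independence number below \<open>m\<close>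
  into the complete graph. Deleting one vertex from each edge shows that a graph with \<open>n\<close> vertices
  and \<open>e\<close> edges has \<open>\<alpha> \<ge> n - e\<close>; if moreover \<open>n < 2e\<close>, the edges cannot all be disjoint,
  so a common vertex of two edges can be deleted and \<open>\<alpha> \<ge> n - e + 1\<close>. Hence each colour class is
  large, and counting edges bounds the order of the complete graph from above. Conversely, a
  matching with \<open>r\<close> edges forces \<open>\<alpha> \<le> n - r\<close>, so packings of matchings give the extremal
  colourings: single edges of \<open>K\<^sub>m\<close>, ten 2-edge matchings in \<open>K\<^sub>7\<close>, and eight perfect matchings
  in \<open>K\<^sub>1\<^sub>0\<close>.\<close>

section \<open>Independence number versus number of edges\<close>

lemma independence_number_ge_iff:
  assumes "finite V"
  shows "m \<le> independence_number V E \<longleftrightarrow> (\<exists>S\<subseteq>V. indep S E \<and> m \<le> card S)"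
proof -
  have "{card S |S. S \<subseteq> V \<and> indep S E} \<subseteq> card ` Pow V"
    by auto
  then have "finite {card S |S. S \<subseteq> V \<and> indep S E}"
    using assms by (meson finite_Pow_iff finite_imageI finite_subset)
  moreover have "{card S |S. S \<subseteq> V \<and> indep S E} \<noteq> {}"
    using null_indep by blast
  ultimately show ?thesis
    unfolding independence_number_def by (subst Max_ge_iff) auto
qed

text \<open>Each edge loses its chosen endpoint, so no edge survives among the remaining
  vertices.\<close>

lemma indep_Diff_image_choice:
  assumes "\<And>e. e \<in> E \<Longrightarrow> v e \<in> e"
  shows "indep (V - v ` E) E"
  unfolding indep_def using assms by (metis DiffD2 empty_iff imageI insert_iff)

lemma card_Diff_image_ge:
  assumes "finite E"
  shows "card V \<le> card (V - v ` E) + card (v ` E)"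
  using diff_card_le_card_Diff[of "v ` E" V] assms by simp

lemma independence_number_ge_card_diff:
  assumes "finite V" "E \<subseteq> [V]\<^bsup>2\<^esup>"
  shows "card V \<le> independence_number V E + card E"
proof -
  have "finite E"
    using assms finite_imp_finite_nsets finite_subset by blast
  have "\<forall>e\<in>E. \<exists>x. x \<in> e"
    using assms(2) unfolding nsets_2_eq by blast
  then obtain v where v: "\<And>e. e \<in> E \<Longrightarrow> v e \<in> e"
    by metis
  have "card (V - v ` E) \<le> independence_number V E"
    using independence_number_ge_iff[OF assms(1)] indep_Diff_image_choice[of E v V] v by blast
  then show ?thesis
    using card_Diff_image_ge[OF \<open>finite E\<close>, of V v] card_image_le[OF \<open>finite E\<close>, of v] by linarith
qed

lemma independence_number_gt_card_diff:
  assumes "finite V" "E \<subseteq> [V]\<^bsup>2\<^esup>" "card V < 2 * card E"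
  shows "card V < independence_number V E + card E"
proof -
  have fin: "finite E"
    using assms finite_imp_finite_nsets finite_subset by blast
  \<comment> \<open>Pairwise disjoint edges would cover \<open>2 * card E\<close> vertices, more
    than \<open>V\<close> has.\<close>
  have "\<not> disjoint E"
  proof
    assume "disjoint E"
    then have "card (\<Union>E) = (\<Sum>e\<in>E. card e)"
      using assms(2) by (intro card_Union_disjoint) (auto simp: nsets_def)
    also have "\<dots> = (\<Sum>e\<in>E. 2)"
      using assms(2) by (intro sum.cong) (auto simp: nsets_def)
    finally have "card (\<Union>E) = 2 * card E"
      by simp
    moreover have "card (\<Union>E) \<le> card V"
      using assms by (intro card_mono) (auto simp: nsets_def)
    ultimately show False
      using assms(3) by linarith
  qed
  then obtain e1 e2 x where e: "e1 \<in> E" "e2 \<in> E" "e1 \<noteq> e2" "x \<in> e1" "x \<in> e2"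
    unfolding disjoint_def by blast
  have "\<forall>e\<in>E. \<exists>y. y \<in> e"
    using assms(2) unfolding nsets_2_eq by blast
  then obtain w where w: "\<And>e. e \<in> E \<Longrightarrow> w e \<in> e"
    by metis
  \<comment> \<open>Choosing \<open>x\<close> for both \<open>e1\<close> and \<open>e2\<close> makes
    \<open>v\<close> non-injective, so at least one deletion is saved.\<close>
  define v where "v e = (if x \<in> e then x else w e)" for e
  have v: "\<And>e. e \<in> E \<Longrightarrow> v e \<in> e"
    using w by (simp add: v_def)
  have "\<not> inj_on v E"
    using e by (metis inj_on_def v_def)
  then have "card (v ` E) < card E"
    using fin by (metis card_image_le eq_card_imp_inj_on le_neq_implies_less)
  moreover have "card (V - v ` E) \<le> independence_number V E"
    using independence_number_ge_iff[OF assms(1)] indep_Diff_image_choice[of E v V] v by blast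
  ultimately show ?thesis
    using card_Diff_image_ge[OF fin, of V v] by linarith
qed

text \<open>Every edge of \<open>M\<close> has an endpoint outside \<open>S\<close>, and disjoint
  edges yield different ones.\<close>

lemma indep_card_matching_le:
  assumes "finite V" "M \<subseteq> [V]\<^bsup>2\<^esup>" "disjoint M" "S \<subseteq> V" "indep S M"
  shows "card S + card M \<le> card V"
proof -
  have "\<exists>x. x \<in> e - S" if e: "e \<in> M" for e
  proof -
    obtain a b where "e = {a, b}" "a \<noteq> b"
      using subsetD[OF assms(2) e] unfolding nsets_2_eq by blast
    then show ?thesis
      using assms(5) e by (auto simp: indep_def)
  qed
  then obtain v where v: "\<And>e. e \<in> M \<Longrightarrow> v e \<in> e - S"
    by metis
  have "inj_on v M"
  proof (rule inj_onI)
    fix e e'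
    assume "e \<in> M" "e' \<in> M" "v e = v e'"
    then have "v e \<in> e \<inter> e'"
      using v by (metis DiffD1 IntI)
    then show "e = e'"
      using disjointD[OF assms(3) \<open>e \<in> M\<close> \<open>e' \<in> M\<close>] by blast
  qed
  moreover have "v ` M \<subseteq> V - S"
    using v assms(2) unfolding nsets_def by blast
  ultimately have "card M \<le> card (V - S)"
    using assms(1) by (metis card_inj_on_le finite_Diff)
  then show ?thesis
    using assms(1,4) by (metis add.commute card_Diff_subset card_mono finite_subset le_diff_conv2)
qed

section \<open>Restriction of colourings and edge counting\<close>

lemma color_alpha_ge_iff:
  "m \<le> color_alpha n f i \<longleftrightarrow> (\<exists>S\<subseteq>{1..n}. indep S (color_class n f i) \<and> m \<le> card S)"
  unfolding color_alpha_def by (rule independence_number_ge_iff) simp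

text \<open>Pairs inside \<open>{1..n}\<close> keep their colour, so an independent set of the small
  graph stays independent in the large one. Hence a good colouring of order \<open>N\<close> yields
  good ones of all smaller orders.\<close>

lemma color_alpha_restrict_le:
  assumes "n \<le> N"
  shows "color_alpha n (restrict f ([{1..n}]\<^bsup>2\<^esup>)) i \<le> color_alpha N f i"
proof -
  obtain S where S: "S \<subseteq> {1..n}" "indep S (color_class n (restrict f ([{1..n}]\<^bsup>2\<^esup>)) i)"
      "color_alpha n (restrict f ([{1..n}]\<^bsup>2\<^esup>)) i \<le> card S"
    using color_alpha_ge_iff by blast
  have "indep S (color_class N f i)"
    unfolding indep_def
  proof (intro ballI impI)
    fix x y
    assume xy: "x \<in> S" "y \<in> S" "x \<noteq> y"
    then have "{x, y} \<in> [{1..n}]\<^bsup>2\<^esup>"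
      using S(1) by auto
    then show "{x, y} \<notin> color_class N f i"
      using S(2) xy by (simp add: indep_def color_class_def)
  qed
  moreover have "S \<subseteq> {1..N}"
    using S(1) assms by auto
  ultimately show ?thesis
    using S(3) color_alpha_ge_iff by blast
qed

text \<open>Pigeonhole: the colour classes are disjoint, so \<open>k\<close> classes of size at
  least \<open>e\<close> would need \<open>k * e\<close> edges.\<close>

lemma exists_small_color_class:
  assumes "f \<in> edge_colorings n k" "n choose 2 < k * e"
  shows "\<exists>i\<in>{1..k}. card (color_class n f i) < e"
proof (rule ccontr)
  assume "\<not> ?thesis"
  then have "(\<Sum>i\<in>{1..k}. e) \<le> (\<Sum>i\<in>{1..k}. card (color_class n f i))"
    by (intro sum_mono) (simp add: not_less)
  also have "\<dots> = card (\<Union>i\<in>{1..k}. color_class n f i)"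
    by (rule card_UN_disjoint[symmetric])
      (auto simp: color_class_def finite_imp_finite_nsets)
  also have "\<dots> \<le> card ([{1..n}]\<^bsup>2\<^esup>)"
    by (rule card_mono) (auto simp: color_class_def finite_imp_finite_nsets)
  finally show False
    using assms(2) by simp
qed

lemma Rbar_diag_eq_Least:
  "Rbar_diag m k =
    (LEAST n. 0 < n \<and> (\<forall>f\<in>edge_colorings n k. \<exists>i\<in>{1..k}. m \<le> color_alpha n f i))"
proof -
  have "(\<exists>i\<in>{1..k}. replicate k m ! (i - 1) \<le> color_alpha n f i) \<longleftrightarrow>
      (\<exists>i\<in>{1..k}. m \<le> color_alpha n f i)" for n f
    by (intro bex_cong) auto
  then show ?thesis
    unfolding Rbar_diag_def Rbar_def length_replicate by presburger
qed

text \<open>Restrictions of \<open>f\<close> rule out every order up to \<open>N\<close>. At order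
  \<open>Suc N\<close> some class has fewer than \<open>e\<close> edges, which by
  \<open>alpha\<close> is too few to keep its independence number below \<open>m\<close>.\<close>

lemma Rbar_diag_eqI:
  assumes f: "f \<in> edge_colorings N k" "\<And>i. i \<in> {1..k} \<Longrightarrow> color_alpha N f i < m"
    and count: "Suc N choose 2 < k * e"
    and alpha: "\<And>E. E \<subseteq> [{1..Suc N}]\<^bsup>2\<^esup> \<Longrightarrow> card E < e \<Longrightarrow> m \<le> independence_number {1..Suc N} E"
  shows "Rbar_diag m k = Suc N"
  unfolding Rbar_diag_eq_Least
proof (rule Least_equality, goal_cases)
  case 1
  have "\<exists>i\<in>{1..k}. m \<le> color_alpha (Suc N) g i" if g: "g \<in> edge_colorings (Suc N) k" for g
  proof -
    obtain i where i: "i \<in> {1..k}" "card (color_class (Suc N) g i) < e"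
      using exists_small_color_class[OF g count] by blast
    have "color_class (Suc N) g i \<subseteq> [{1..Suc N}]\<^bsup>2\<^esup>"
      by (auto simp: color_class_def)
    then show ?thesis
      using alpha i unfolding color_alpha_def by blast
  qed
  then show ?case
    by blast
next
  case (2 n)
  show ?case
  proof (rule ccontr)
    assume "\<not> Suc N \<le> n"
    then have "n \<le> N"
      by simp
    define g where "g = restrict f ([{1..n}]\<^bsup>2\<^esup>)"
    have "[{1..n}]\<^bsup>2\<^esup> \<subseteq> [{1..N}]\<^bsup>2\<^esup>"
      using \<open>n \<le> N\<close> by (intro nsets_mono) simp
    then have "g \<in> edge_colorings n k"
      using f(1) unfolding g_def edge_colorings_def by (auto simp: PiE_iff)
    then obtain i where i: "i \<in> {1..k}" "m \<le> color_alpha n g i"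
      using 2 by blast
    then show False
      using f(2)[of i] color_alpha_restrict_le[OF \<open>n \<le> N\<close>, of f i] unfolding g_def by simp
  qed
qed

section \<open>Colourings from packings of matchings\<close>

lemma edge_coloring_of_matching_packing:
  assumes sub: "\<And>i. i \<in> {1..k} \<Longrightarrow> M i \<subseteq> [{1..N}]\<^bsup>2\<^esup>"
    and matching: "\<And>i. i \<in> {1..k} \<Longrightarrow> disjoint (M i)"
    and size: "\<And>i. i \<in> {1..k} \<Longrightarrow> N < card (M i) + m"
    and disj: "disjoint_family_on M {1..k}"
    and "0 < k"
  shows "\<exists>f\<in>edge_colorings N k. \<forall>i\<in>{1..k}. color_alpha N f i < m"
proof -
  \<comment> \<open>Edges in no matching get colour 1. This is harmless, since enlarging a class
    cannot increase its independence number.\<close>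
  define c where
    "c e = (if \<exists>i\<in>{1..k}. e \<in> M i then SOME i. i \<in> {1..k} \<and> e \<in> M i else 1)" for e
  have c_eq: "c e = i" if "i \<in> {1..k}" "e \<in> M i" for e i
  proof -
    have "(SOME i. i \<in> {1..k} \<and> e \<in> M i) = i"
      using that disj unfolding disjoint_family_on_def by (intro some_equality) blast+
    then show ?thesis
      using that by (auto simp: c_def)
  qed
  define f where "f = restrict c ([{1..N}]\<^bsup>2\<^esup>)"
  have "c e \<in> {1..k}" for e
  proof (cases "\<exists>i\<in>{1..k}. e \<in> M i")
    case True
    then show ?thesis
      using c_eq by blast
  next
    case False
    then show ?thesis
      using \<open>0 < k\<close> by (auto simp: c_def)
  qed
  then have "f \<in> edge_colorings N k"
    by (auto simp: f_def edge_colorings_def)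
  moreover have "color_alpha N f i < m" if i: "i \<in> {1..k}" for i
  proof (rule ccontr)
    assume "\<not> color_alpha N f i < m"
    then obtain S where S: "S \<subseteq> {1..N}" "indep S (color_class N f i)" "m \<le> card S"
      by (auto simp: not_less color_alpha_ge_iff)
    have "M i \<subseteq> color_class N f i"
      using c_eq[OF i] sub[OF i] by (auto simp: f_def color_class_def)
    then have "indep S (M i)"
      using S(2) by (auto simp: indep_def)
    then have "card S + card (M i) \<le> N"
      using indep_card_matching_le[OF _ sub[OF i] matching[OF i] S(1)] by simp
    then show False
      using S(3) size[OF i] by linarith
  qed
  ultimately show ?thesis
    by blast
qed

lemma distinct_concat_nth_disjoint:
  assumes "distinct (concat L)" "i < length L" "j < length L" "i \<noteq> j"
  shows "set (L ! i) \<inter> set (L ! j) = {}"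
  using assms
proof (induction i j rule: linorder_wlog)
  case (le i j)
  then have "L ! j \<in> set (drop (Suc i) L)"
    by (auto simp: in_set_conv_nth intro!: exI[of _ "j - Suc i"])
  moreover have "distinct (concat (take i L @ L ! i # drop (Suc i) L))"
    using le by (simp add: id_take_nth_drop[symmetric])
  ultimately show ?case
    by auto
next
  case (sym i j)
  then show ?case
    by (simp add: Int_commute)
qed

text \<open>A form in which concrete packings can be checked by evaluation. Writing edges as pairs
  with \<open>a < b\<close> makes the passage to two-element sets injective, so distinctness of list
  entries gives disjointness of the matchings.\<close>

lemma edge_coloring_of_matching_lists:
  assumes "L \<noteq> []" and dist: "distinct (concat L)"
    and edges: "\<forall>(a, b)\<in>set (concat L). 1 \<le> a \<and> a < b \<and> b \<le> N"
    and matching: "\<forall>ps\<in>set L. distinct (concat (map (\<lambda>(a, b). [a, b]) ps)) \<and> N < length ps + m"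
  shows "\<exists>f\<in>edge_colorings N (length L). \<forall>i\<in>{1..length L}. color_alpha N f i < m"
proof -
  define d :: "nat \<times> nat \<Rightarrow> nat set" where "d = (\<lambda>(a, b). {a, b})"
  define M where "M i = d ` set (L ! (i - 1))" for i
  have mem: "L ! (i - 1) \<in> set L" if "i \<in> {1..length L}" for i
    using that by auto
  have inj: "inj_on d (set (concat L))"
  proof (rule inj_onI)
    fix p q
    assume "p \<in> set (concat L)" "q \<in> set (concat L)" "d p = d q"
    moreover from this have "fst p < snd p" "fst q < snd q"
      using edges by (auto simp: case_prod_beta)
    ultimately show "p = q"
      by (auto simp: d_def case_prod_beta doubleton_eq_iff prod_eq_iff)
  qed
  have inj': "inj_on d (set ps)" if "ps \<in> set L" for ps
    using inj that by (auto intro: inj_on_subset)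
  have disj_ps: "disjoint (d ` set ps)" if "distinct (concat (map (\<lambda>(a, b). [a, b]) ps))" for ps
    using that
  proof (induction ps)
    case Nil
    then show ?case by simp
  next
    case (Cons p ps)
    then show ?case
      by (cases p) (fastforce simp: d_def disjoint_def)
  qed
  show ?thesis
  proof (rule edge_coloring_of_matching_packing[where M = M])
    fix i
    assume i: "i \<in> {1..length L}"
    show "M i \<subseteq> [{1..N}]\<^bsup>2\<^esup>"
      using mem[OF i] edges by (fastforce simp: M_def d_def)
    show "disjoint (M i)"
      using matching mem[OF i] disj_ps by (auto simp: M_def)
    have "distinct (L ! (i - 1))"
      using dist mem[OF i] by (simp add: distinct_concat_iff)
    then have "card (M i) = length (L ! (i - 1))"
      using inj'[OF mem[OF i]] by (simp add: M_def card_image distinct_card)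
    then show "N < card (M i) + m"
      using matching mem[OF i] by auto
  next
    show "disjoint_family_on M {1..length L}"
      unfolding disjoint_family_on_def
    proof (intro ballI impI)
      fix i j
      assume ij: "i \<in> {1..length L}" "j \<in> {1..length L}" "i \<noteq> j"
      have "set (L ! (i - 1)) \<inter> set (L ! (j - 1)) = {}"
        using ij by (intro distinct_concat_nth_disjoint[OF dist]) auto
      then show "M i \<inter> M j = {}"
        using inj mem[OF ij(1)] mem[OF ij(2)] unfolding M_def
        by (subst inj_on_image_Int[OF inj, symmetric]) auto
    qed
  next
    show "0 < length L"
      using assms(1) by simp
  qed
qed

section \<open>Exact values\<close>

lemma edge_coloring_single_edges:
  assumes "0 < k" "k \<le> m choose 2"
  shows "\<exists>f\<in>edge_colorings m k. \<forall>i\<in>{1..k}. color_alpha m f i < m"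
proof -
  have "card {1..k} \<le> card ([{1..m}]\<^bsup>2\<^esup>)"
    using assms(2) by simp
  then obtain g where g: "g ` {1..k} \<subseteq> [{1..m}]\<^bsup>2\<^esup>" "inj_on g {1..k}"
    using card_le_inj[of "{1..k}" "[{1..m}]\<^bsup>2\<^esup>"] by (auto simp: finite_imp_finite_nsets)
  show ?thesis
  proof (rule edge_coloring_of_matching_packing[where M = "\<lambda>i. {g i}"])
    show "disjoint_family_on (\<lambda>i. {g i}) {1..k}"
      using g(2) unfolding disjoint_family_on_def by (simp add: inj_on_eq_iff)
  qed (use g(1) assms(1) in auto)
qed

text \<open>On \<open>Suc m\<close> vertices some colour has at most one edge, and deleting an
  endpoint of it leaves \<open>m\<close> independent vertices. On \<open>m\<close> vertices one edge
  per colour suffices.\<close>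

lemma Rbar_diag_eq_Suc:
  assumes "0 < k" "k \<le> m choose 2" "Suc m choose 2 < k * 2"
  shows "Rbar_diag m k = Suc m"
proof -
  obtain f where f: "f \<in> edge_colorings m k" "\<And>i. i \<in> {1..k} \<Longrightarrow> color_alpha m f i < m"
    using edge_coloring_single_edges[OF assms(1,2)] by blast
  show ?thesis
    using f assms(3)
  proof (rule Rbar_diag_eqI)
    fix E
    assume "E \<subseteq> [{1..Suc m}]\<^bsup>2\<^esup>" "card E < 2"
    then show "m \<le> independence_number {1..Suc m} E"
      using independence_number_ge_card_diff[of "{1..Suc m}" E] by simp
  qed
qed

lemma Rbar_diag_6_10: "Rbar_diag 6 10 = 8"
proof -
  \<comment> \<open>These matchings use 20 of the 21 edges; only \<open>{6, 7}\<close> is left over.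
    Each forces \<alpha> \<le> 7 - 2.\<close>
  define L :: "(nat \<times> nat) list list" where "L =
    [[(1, 2), (3, 4)], [(1, 3), (2, 4)], [(1, 4), (2, 3)], [(1, 5), (2, 6)], [(1, 6), (2, 5)],
     [(1, 7), (3, 5)], [(2, 7), (3, 6)], [(3, 7), (4, 5)], [(4, 6), (5, 7)], [(4, 7), (5, 6)]]"
  have "\<exists>f\<in>edge_colorings 7 (length L). \<forall>i\<in>{1..length L}. color_alpha 7 f i < 6"
    by (rule edge_coloring_of_matching_lists) (simp_all add: L_def)
  moreover have "length L = 10"
    by (simp add: L_def)
  ultimately obtain f where f: "f \<in> edge_colorings 7 10"
      "\<And>i. i \<in> {1..10} \<Longrightarrow> color_alpha 7 f i < 6"
    by auto
  have "Rbar_diag 6 10 = Suc 7"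
  \<comment> \<open>Among 28 edges in 10 colours some colour has at most 2, so \<alpha> \<ge> 8 -
    2.\<close>
  proof (rule Rbar_diag_eqI[OF f, where e = 3])
    show "Suc 7 choose 2 < 10 * 3"
      by (simp add: choose_two)
    fix E
    assume "E \<subseteq> [{1..Suc 7}]\<^bsup>2\<^esup>" "card E < 3"
    then show "6 \<le> independence_number {1..Suc 7} E"
      using independence_number_ge_card_diff[of "{1..Suc 7}" E] by simp
  qed
  then show ?thesis
    by simp
qed

lemma Rbar_diag_6_8: "Rbar_diag 6 8 = 11"
proof -
  \<comment> \<open>The pairs in the \<open>c\<close>-th matching, \<open>0 \<le> c < 8\<close>, are those with sum \<open>c\<close> modulo 9,
    where the partner of 10 is the \<open>x\<close> with \<open>2x = c\<close> modulo 9.\<close>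
  define L :: "(nat \<times> nat) list list" where "L =
    [[(1, 8), (2, 7), (3, 6), (4, 5), (9, 10)], [(1, 9), (2, 8), (3, 7), (4, 6), (5, 10)],
     [(2, 9), (3, 8), (4, 7), (5, 6), (1, 10)], [(1, 2), (3, 9), (4, 8), (5, 7), (6, 10)],
     [(1, 3), (4, 9), (5, 8), (6, 7), (2, 10)], [(1, 4), (2, 3), (5, 9), (6, 8), (7, 10)],
     [(1, 5), (2, 4), (6, 9), (7, 8), (3, 10)], [(1, 6), (2, 5), (3, 4), (7, 9), (8, 10)]]"
  have "\<exists>f\<in>edge_colorings 10 (length L). \<forall>i\<in>{1..length L}. color_alpha 10 f i < 6"
    by (rule edge_coloring_of_matching_lists) (simp_all add: L_def)
  moreover have "length L = 8"
    by (simp add: L_def)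
  ultimately obtain f where f: "f \<in> edge_colorings 10 8"
      "\<And>i. i \<in> {1..8} \<Longrightarrow> color_alpha 10 f i < 6"
    by auto
  have "Rbar_diag 6 8 = Suc 10"
  \<comment> \<open>There are 55 edges, one short of 7 for each of the 8 colours.\<close>
  proof (rule Rbar_diag_eqI[OF f, where e = 7])
    show "Suc 10 choose 2 < 8 * 7"
      by (simp add: choose_two)
    fix E
    assume E: "E \<subseteq> [{1..Suc 10}]\<^bsup>2\<^esup>" "card E < 7"
    show "6 \<le> independence_number {1..Suc 10} E"
    \<comment> \<open>Six edges are the critical case: plain deletion gives only 5, but 11 < 12
      means two edges meet, which gains one vertex.\<close>
    proof (cases "card E = 6")
      case True
      then show ?thesis
        using independence_number_gt_card_diff[of "{1..Suc 10}" E] E by simp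
    next
      case False
      then show ?thesis
        using independence_number_ge_card_diff[of "{1..Suc 10}" E] E by simp
    qed
  qed
  then show ?thesis
    by simp
qed

theorem theorem6p4:
  shows "Rbar_diag 4 6 = 5
    \<and> (\<forall>k. 8 \<le> k \<and> k \<le> 10 \<longrightarrow> Rbar_diag 5 k = 6)
    \<and> (Rbar_diag 6 8 = 11 \<and> Rbar_diag 6 10 = 8
        \<and> (\<forall>k. 11 \<le> k \<and> k \<le> 15 \<longrightarrow> Rbar_diag 6 k = 7))"
proof (intro conjI allI impI)
  show "Rbar_diag 4 6 = 5"
    using Rbar_diag_eq_Suc[of 6 4] by (simp add: choose_two)
  \<comment> \<open>The bounds on \<open>k\<close> are exactly the hypotheses of
    \<open>Rbar_diag_eq_Suc\<close>: here 15 < 2k and k \<le> 10, below 21 < 2k and k \<le>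
    15.\<close>
  show "Rbar_diag 5 k = 6" if "8 \<le> k \<and> k \<le> 10" for k
    using Rbar_diag_eq_Suc[of k 5] that by (simp add: choose_two)
  show "Rbar_diag 6 k = 7" if "11 \<le> k \<and> k \<le> 15" for k
    using Rbar_diag_eq_Suc[of k 6] that by (simp add: choose_two)
qed (fact Rbar_diag_6_8 Rbar_diag_6_10)+

end
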